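(* For any almost embedding $f : K_4 \to \mathbb{R}^2$ we have $$w_f(234,1)+w_f(134,2)+w_f(124,3)+w_f(123,4) \equiv 1 \pmod 2.$$
   Context: For points $A\neq O$, $B\neq O$ in the plane, the oriented angle $\angle AOB$ is the number $t\in(-\pi,\pi]$ such that $\overrightarrow{OB}$ is codirected with the vector obtained from $\overrightarrow{OA}$ by counterclockwise rotation through $t$. A closed polygonal line $A_1\dots A_m$ is the cyclic sequence of segments $A_1A_2,\dots,A_{m-1}A_m,A_mA_1$. If it does not pass through a point $O$, its winding number is defined by $2\pi\, w(A_1\dots A_m,O):=\angle A_1OA_2+\dots+\angle A_{m-1}OA_m+\angle A_mOA_1$. $K_n$ is the complete graph on vertex set $\{1,\dots,n\}$. A (piecewise-linear) map $f:K\to\mathbb{R}^2$ of a graph $K$ consists of a point $f(v)$ for each vertex $v$ and, for each edge $uv$, a polygonal line $f|_{uv}$ joining $f(u)$ to $f(v)$ (with $f|_{vu}$ its reverse); $f(\sigma)$ denotes the union of segments of $f|_\sigma$, and the image of a set of edges is the union of their images. For a directed cycle $C=v_1\dots v_n$ in $K$, $f|_C$ is the closed polygonal line formed by $f|_{v_1v_2},\dots,f|_{v_{n-1}v_n},f|_{v_nv_1}$ in this order. For a vertex $v$ with $f(v)\notin f(C)$, put $w_f(C,v):=w(f|_C,f(v))$. A map $f$ is an almost embedding if $f(\alpha)\cap f(\beta)=\emptyset$ for any two non-adjacent simplices $\alpha,\beta$ (vertices or edges), i.e. images of non-adjacent edges are disjoint, the image of a vertex is not in the image of any edge not containing it, and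 images of distinct vertices are distinct. *)

theory Defs
  imports "HOL-Analysis.Analysis" "HOL-Library.Real_Mod"
begin

text \<open>
  The plane is \<^typ>\<open>complex\<close>; counterclockwise rotation through \<open>t\<close> is multiplication by
  \<open>cis t\<close>. The value below is meaningful only for \<open>A \<noteq> P\<close> and \<open>B \<noteq> P\<close>.
\<close>

definition oriented_angle :: "complex \<Rightarrow> complex \<Rightarrow> complex \<Rightarrow> real" where
  "oriented_angle A P B =
     (THE t. t \<in> {-pi<..pi} \<and> (\<exists>r>0. B - P = r *\<^sub>R (cis t * (A - P))))"

lemma oriented_angle_eq_Arg:
  assumes "A \<noteq> P" and "B \<noteq> P"
  shows "oriented_angle A P B = Arg ((B - P) / (A - P))"
  unfolding oriented_angle_def
proof (rule the_equality)
  define z where "z = (B - P) / (A - P)"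
  have z0: "z \<noteq> 0" and BP: "B - P = z * (A - P)"
    using assms by (auto simp: z_def)
  have "z = cmod z *\<^sub>R cis (Arg z)"
    using z0 by (simp add: cis_Arg sgn_div_norm)
  hence "B - P = cmod z *\<^sub>R (cis (Arg z) * (A - P))"
    using BP by (metis mult_scaleR_left)
  moreover have "cmod z > 0" using z0 by simp
  ultimately show "Arg ((B - P) / (A - P)) \<in> {-pi<..pi} \<and>
      (\<exists>r>0. B - P = r *\<^sub>R (cis (Arg ((B - P) / (A - P))) * (A - P)))"
    using Arg_bounded[of z] unfolding z_def
    by (intro conjI exI[of _ "cmod ((B - P) / (A - P))"]) auto
next
  fix t assume t: "t \<in> {-pi<..pi} \<and> (\<exists>r>0. B - P = r *\<^sub>R (cis t * (A - P)))"
  then obtain r where r: "r > 0" "B - P = r *\<^sub>R (cis t * (A - P))" by blast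
  have "(B - P) / (A - P) = r *\<^sub>R cis t"
    using assms r(2) by (simp add: scaleR_conv_of_real)
  moreover have "sgn (r *\<^sub>R cis t) = cis t"
    using r(1) by (simp add: sgn_div_norm)
  ultimately show "t = Arg ((B - P) / (A - P))"
    using t by (intro cis_Arg_unique[symmetric]) auto
qed

text \<open>
  A closed polygonal line is given by the list of its consecutive vertices, with no repetition of
  the first vertex at the end.
\<close>

definition closed_line_winding :: "complex list \<Rightarrow> complex \<Rightarrow> real" where
  "closed_line_winding A P =
     (\<Sum>i<length A. oriented_angle (A ! i) P (A ! (Suc i mod length A))) / (2 * pi)"

lemma closed_line_winding_in_Ints:
  assumes "P \<notin> set A"
  shows "closed_line_winding A P \<in> \<int>"
proof -
  define m where "m = length A"
  define z where "z i = A ! i - P" for i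
  define s where "s = (\<Sum>i<m. oriented_angle (A ! i) P (A ! (Suc i mod m)))"
  have z0: "z i \<noteq> 0" if "i < m" for i
    using that assms nth_mem[of i A] by (auto simp: z_def m_def)
  have less: "Suc i mod m < m" if "i < m" for i
    using that by (intro mod_less_divisor) auto
  have bij: "bij_betw (\<lambda>i. Suc i mod m) {..<m} {..<m}"
  proof -
    have "inj_on (\<lambda>i. Suc i mod m) {..<m}"
      by (auto simp: inj_on_def mod_Suc split: if_splits)
    thus ?thesis
      using less by (intro bij_betw_imageI endo_inj_surj) auto
  qed
  have cis_sum: "cis (\<Sum>i<k. g i) = (\<Prod>i<k. cis (g i))" for k :: nat and g
    by (induction k) (auto simp: cis_mult[symmetric])
  have "cis s = (\<Prod>i<m. cis (oriented_angle (A ! i) P (A ! (Suc i mod m))))"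
    unfolding s_def by (rule cis_sum)
  also have "\<dots> = (\<Prod>i<m. sgn (z (Suc i mod m)) / sgn (z i))"
  proof (rule prod.cong, goal_cases)
    case (2 i)
    hence "z i \<noteq> 0" "z (Suc i mod m) \<noteq> 0"
      using z0 less by auto
    thus ?case
      by (simp add: oriented_angle_eq_Arg cis_Arg sgn_divide z_def)
  qed simp
  also have "\<dots> = (\<Prod>i<m. sgn (z (Suc i mod m))) / (\<Prod>i<m. sgn (z i))"
    by (rule prod_dividef)
  also have "(\<Prod>i<m. sgn (z (Suc i mod m))) = (\<Prod>i<m. sgn (z i))"
    by (rule prod.reindex_bij_betw[OF bij])
  also have "(\<Prod>i<m. sgn (z i)) / (\<Prod>i<m. sgn (z i)) = 1"
    using z0 by (simp add: sgn_zero_iff)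
  finally have "cos s = 1"
    by (simp add: complex_eq_iff)
  then obtain k :: int where "s = of_int k * (2 * pi)"
    using cos_one_2pi_int[of s] by (auto simp: algebra_simps)
  hence "closed_line_winding A P = of_int k"
    by (simp add: closed_line_winding_def s_def m_def)
  thus ?thesis by simp
qed

definition line_image :: "complex list \<Rightarrow> complex set" where
  "line_image L = (\<Union>i\<in>{i. Suc i < length L}. closed_segment (L ! i) (L ! Suc i))"

text \<open>A graph is a pair of its vertex set and its set of edges (two-element sets of vertices).\<close>

type_synonym 'v graph = "'v set \<times> 'v set set"

definition complete_graph :: "nat \<Rightarrow> nat graph" where
  "complete_graph n = ({1..n}, {{u, v} |u v. u \<in> {1..n} \<and> v \<in> {1..n} \<and> u \<noteq> v})"

text \<open>
  \<open>edge_line f u v\<close> is the list of consecutive vertices of the polygonal line \<open>f|\<^bsub>uv\<^esub>\<close>,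
  traversed from \<open>f(u)\<close> to \<open>f(v)\<close>. Values on non-vertices and non-edges are junk.
\<close>

record 'v plane_map =
  vertex_point :: "'v \<Rightarrow> complex"
  edge_line :: "'v \<Rightarrow> 'v \<Rightarrow> complex list"

text \<open>
  The bound on the length only says that there is at least one (possibly degenerate) segment.
\<close>

definition is_plane_map :: "'v graph \<Rightarrow> 'v plane_map \<Rightarrow> bool" where
  "is_plane_map K f \<longleftrightarrow>
     (\<forall>u v. {u, v} \<in> snd K \<longrightarrow>
        2 \<le> length (edge_line f u v) \<and>
        hd (edge_line f u v) = vertex_point f u \<and>
        last (edge_line f u v) = vertex_point f v \<and>
        edge_line f v u = rev (edge_line f u v))"

definition almost_embedding :: "'v graph \<Rightarrow> 'v plane_map \<Rightarrow> bool" where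
  "almost_embedding K f \<longleftrightarrow>
     is_plane_map K f \<and>
     (\<forall>u v x y. {u, v} \<in> snd K \<and> {x, y} \<in> snd K \<and> {u, v} \<inter> {x, y} = {} \<longrightarrow>
        line_image (edge_line f u v) \<inter> line_image (edge_line f x y) = {}) \<and>
     (\<forall>w u v. w \<in> fst K \<and> {u, v} \<in> snd K \<and> w \<notin> {u, v} \<longrightarrow>
        vertex_point f w \<notin> line_image (edge_line f u v)) \<and>
     inj_on (vertex_point f) (fst K)"

text \<open>
  A directed cycle is the list of its vertices. The end point of each edge line is dropped, since
  it is the starting point of the next one.
\<close>

definition cycle_line :: "'v plane_map \<Rightarrow> 'v list \<Rightarrow> complex list" where
  "cycle_line f C =
     concat (map (\<lambda>i. butlast (edge_line f (C ! i) (C ! (Suc i mod length C)))) [0..<length C])"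

text \<open>As in the definition of the angle, this is meaningful only if the point \<open>f(v)\<close> is off \<open>f(C)\<close>.\<close>

definition cycle_winding :: "'v plane_map \<Rightarrow> 'v list \<Rightarrow> 'v \<Rightarrow> real" where
  "cycle_winding f C v = closed_line_winding (cycle_line f C) (vertex_point f v)"

end

theory Submission
  imports Defs
begin

text \<open>
  Let \<open>\<theta>(L, P)\<close> be the total angle swept along a line \<open>L\<close> as seen from \<open>P\<close>. If the lines \<open>L\<close>
  from \<open>a\<close> to \<open>b\<close> and \<open>M\<close> from \<open>c\<close> to \<open>d\<close> are disjoint, then the difference of a point of \<open>M\<close> and
  a point of \<open>L\<close> never vanishes, so its argument does not change along the boundary of the
  parameter square, which means \<open>\<theta>(M, a) - \<theta>(M, b) = \<theta>(L, c) - \<theta>(L, d)\<close>. Applying this to the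
  three pairs of opposite edges turns the alternating sum of the four winding numbers into
  \<open>2 w(234, 1) - (\<theta>(34, 2) + \<theta>(42, 3) + \<theta>(23, 4)) / \<pi>\<close>. Modulo \<open>2\<pi>\<close> the three angles are those of
  the triangle \<open>f(2) f(3) f(4)\<close>, so their sum is an odd multiple of \<open>\<pi>\<close>.
\<close>

section \<open>Swept angles and images of polygonal lines\<close>

fun line_angle :: "complex list \<Rightarrow> complex \<Rightarrow> real" where
  "line_angle (A # B # L) P = oriented_angle A P B + line_angle (B # L) P"
| "line_angle _ P = 0"

lemma line_image_simps [simp]:
  "line_image [] = {}"
  "line_image [A] = {}"
  "line_image (A # B # L) = closed_segment A B \<union> line_image (B # L)"
proof -
  have "{i. Suc i < length (A # B # L)} = insert 0 (Suc ` {i. Suc i < length (B # L)})"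
    by (auto simp: image_iff) (metis less_Suc_eq_0_disj)
  thus "line_image (A # B # L) = closed_segment A B \<union> line_image (B # L)"
    unfolding line_image_def by simp
qed (auto simp: line_image_def)

text \<open>The length bound matters because a one-point list has no segments and hence an empty
  image.\<close>

lemma set_subset_line_image: "2 \<le> length L \<Longrightarrow> set L \<subseteq> line_image L"
proof (induction L rule: induct_list012)
  case (3 A B L)
  thus ?case by (cases L) auto
qed auto

section \<open>Exchange of swept angles between disjoint lines\<close>

text \<open>Both arguments lie strictly between -\<pi>/2 and \<pi>/2, so their difference is already
  in the principal range and no multiple of 2\<pi> enters.\<close>

lemma Arg_divide_right_half_plane:
  assumes "Re z > 0" "Re w > 0"
  shows "Arg (z / w) = Arg z - Arg w"
proof (rule cis_Arg_unique)
  have "z \<noteq> 0" "w \<noteq> 0" using assms by auto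
  thus "sgn (z / w) = cis (Arg z - Arg w)"
    by (simp add: sgn_divide cis_divide[symmetric] cis_Arg)
  have "\<bar>Arg z\<bar> < pi / 2" "\<bar>Arg w\<bar> < pi / 2"
    using assms Arg_Re_pos by blast+
  thus "- pi < Arg z - Arg w" "Arg z - Arg w \<le> pi" by linarith+
qed

text \<open>A line strictly separating the segments puts all differences of a point of
  \<open>CD\<close> and a point of \<open>AB\<close> into one open half-plane, where a single branch
  \<open>a\<close> of the argument serves for both families of angles.\<close>

lemma disjoint_segments_angle:
  assumes "closed_segment A B \<inter> closed_segment C D = {}"
  obtains a :: "complex \<Rightarrow> real" where
    "\<And>x S T. x \<in> closed_segment A B \<Longrightarrow> S \<in> closed_segment C D \<Longrightarrow> T \<in> closed_segment C D \<Longrightarrow>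
       oriented_angle S x T = a (T - x) - a (S - x)"
    "\<And>x S T. x \<in> closed_segment C D \<Longrightarrow> S \<in> closed_segment A B \<Longrightarrow> T \<in> closed_segment A B \<Longrightarrow>
       oriented_angle S x T = a (x - T) - a (x - S)"
proof -
  obtain u \<beta> where u: "\<And>x. x \<in> closed_segment A B \<Longrightarrow> u \<bullet> x < \<beta>"
    "\<And>y. y \<in> closed_segment C D \<Longrightarrow> u \<bullet> y > \<beta>"
    using separating_hyperplane_compact_closed[of "closed_segment A B" "closed_segment C D"] assms
    by (metis closed_segment convex_closed_segment compact_segment ends_in_segment(1) empty_iff)
  \<comment> \<open>Since \<open>Re (cnj u * z)\<close> is the inner product of \<open>u\<close> and
    \<open>z\<close>, multiplication by \<open>cnj u\<close> carries that half-plane to the right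
    half-plane.\<close>
  define a where "a z = Arg (cnj u * z)" for z
  have pos: "Re (cnj u * (y - x)) > 0"
    if "x \<in> closed_segment A B" "y \<in> closed_segment C D" for x y
    using u(1)[OF that(1)] u(2)[OF that(2)] by (simp add: inner_complex_def algebra_simps)
  have ratio: "Arg (z / w) = a z - a w" if "Re (cnj u * z) > 0" "Re (cnj u * w) > 0" for z w
  proof -
    have "z / w = (cnj u * z) / (cnj u * w)" using that by auto
    thus ?thesis using Arg_divide_right_half_plane[OF that] by (simp add: a_def)
  qed
  show ?thesis
  proof (rule that[of a])
    fix x S T
    assume *: "x \<in> closed_segment A B" "S \<in> closed_segment C D" "T \<in> closed_segment C D"
    with assms have "S \<noteq> x" "T \<noteq> x" by auto
    thus "oriented_angle S x T = a (T - x) - a (S - x)"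
      using * by (simp add: oriented_angle_eq_Arg ratio[OF pos pos])
  next
    fix x S T
    assume *: "x \<in> closed_segment C D" "S \<in> closed_segment A B" "T \<in> closed_segment A B"
    with assms have "S \<noteq> x" "T \<noteq> x" by auto
    \<comment> \<open>Negating both differences keeps the quotient, so the same \<open>a\<close>
      measures angles seen from the other segment.\<close>
    moreover have "(T - x) / (S - x) = (x - T) / (x - S)"
      by (metis minus_diff_eq minus_divide_divide)
    ultimately show "oriented_angle S x T = a (x - T) - a (x - S)"
      using * by (simp add: oriented_angle_eq_Arg ratio[OF pos pos])
  qed
qed

text \<open>Both sides expand to the same alternating sum of \<open>a\<close> at
  \<open>C - A\<close>, \<open>D - A\<close>, \<open>C - B\<close> and \<open>D - B\<close>.\<close>

lemma segment_angle_exchange: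
  assumes "closed_segment A B \<inter> closed_segment C D = {}"
  shows "oriented_angle C A D - oriented_angle C B D = oriented_angle A C B - oriented_angle A D B"
  by (rule disjoint_segments_angle[OF assms]) simp

text \<open>Antisymmetry would fail for the angle \<pi>, that is, for \<open>P\<close> strictly
  between \<open>A\<close> and \<open>B\<close>. The proof treats \<open>P\<close> as a degenerate
  segment disjoint from \<open>AB\<close>.\<close>

lemma oriented_angle_swap:
  assumes "P \<notin> closed_segment A B"
  shows "oriented_angle B P A = - oriented_angle A P B"
  by (rule disjoint_segments_angle[of P P A B]) (use assms in auto)

text \<open>Adding the segment identity along \<open>M\<close> telescopes: the angles of
  \<open>AB\<close> seen from inner vertices of \<open>M\<close> cancel.\<close>

lemma segment_line_angle_exchange:
  assumes "M \<noteq> []" "closed_segment A B \<inter> line_image M = {}"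
  shows "line_angle M A - line_angle M B = oriented_angle A (hd M) B - oriented_angle A (last M) B"
  using assms
proof (induction M rule: induct_list012)
  case (3 C D M)
  have "closed_segment A B \<inter> closed_segment C D = {}"
    using "3.prems" by auto
  moreover have "line_angle (D # M) A - line_angle (D # M) B
      = oriented_angle A D B - oriented_angle A (last (D # M)) B"
    using "3.prems" "3.IH"(2) by (simp add: Int_Un_distrib)
  ultimately show ?case
    using segment_angle_exchange[of A B C D] by simp
qed auto

text \<open>A second telescoping, now along \<open>L\<close>.\<close>

lemma line_angle_exchange:
  assumes "L \<noteq> []" "M \<noteq> []" "line_image L \<inter> line_image M = {}"
  shows "line_angle M (hd L) - line_angle M (last L) = line_angle L (hd M) - line_angle L (last M)"
  using assms
proof (induction L rule: induct_list012)
  case (3 A B L)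
  have "closed_segment A B \<inter> line_image M = {}"
    using "3.prems" by auto
  moreover have "line_angle M B - line_angle M (last (B # L))
      = line_angle (B # L) (hd M) - line_angle (B # L) (last M)"
    using "3.prems" "3.IH"(2) by (simp add: Int_Un_distrib2)
  ultimately show ?case
    using segment_line_angle_exchange[of M A B] "3.prems" by simp
qed auto

section \<open>Concatenation, reversal and swept angles modulo 2\<pi>\<close>

lemma line_angle_append:
  assumes "L \<noteq> []" "M \<noteq> []" "last L = hd M"
  shows "line_angle (butlast L @ M) P = line_angle L P + line_angle M P"
  using assms
proof (induction L rule: induct_list012)
  case (2 A)
  thus ?case by simp
next
  case (3 A B L)
  have "line_angle (A # butlast (B # L) @ M) P
      = oriented_angle A P B + line_angle (butlast (B # L) @ M) P"
    using "3.prems" by (cases L; cases M) auto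
  thus ?case using "3.prems" "3.IH"(2) by simp
qed auto

lemma line_angle_rev:
  assumes "P \<notin> line_image L"
  shows "line_angle (rev L) P = - line_angle L P"
  using assms
proof (induction L rule: induct_list012)
  case (3 A B L)
  have "line_angle (rev (A # B # L)) P = line_angle (butlast (rev (B # L)) @ [B, A]) P"
    by simp
  also have "\<dots> = line_angle (rev (B # L)) P + oriented_angle B P A"
    by (subst line_angle_append) auto
  finally show ?case
    using "3.prems" "3.IH"(2) oriented_angle_swap[of P A B] by simp
qed auto

text \<open>The product of the unit direction quotients telescopes, so modulo 2\<pi> only the end
  points of the line count.\<close>

lemma cis_line_angle:
  assumes "P \<notin> set L" "L \<noteq> []"
  shows "cis (line_angle L P) = sgn (last L - P) / sgn (hd L - P)"
  using assms
proof (induction L rule: induct_list012)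
  case (3 A B L)
  have "cis (oriented_angle A P B) = sgn (B - P) / sgn (A - P)"
    using "3.prems" oriented_angle_eq_Arg[of A P B] by (auto simp: cis_Arg sgn_divide)
  thus ?case
    using "3.prems" "3.IH"(2) by (auto simp: cis_mult[symmetric] sgn_zero_iff)
qed (auto simp: sgn_zero_iff)

lemma line_angle_conv_sum:
  "line_angle L P = (\<Sum>i<length L - 1. oriented_angle (L ! i) P (L ! Suc i))"
proof (induction L rule: induct_list012)
  case (3 A B L)
  thus ?case by (simp add: sum.lessThan_Suc_shift del: sum.lessThan_Suc)
qed auto

section \<open>Winding numbers of 3-cycles\<close>

lemma closed_line_winding_conv_line_angle:
  assumes "A \<noteq> []"
  shows "closed_line_winding A P = line_angle (A @ [hd A]) P / (2 * pi)"
proof -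
  have "(A @ [hd A]) ! Suc i = A ! (Suc i mod length A)" if "i < length A" for i
    using that assms by (cases "Suc i = length A") (auto simp: nth_append hd_conv_nth)
  thus ?thesis
    unfolding closed_line_winding_def line_angle_conv_sum by (simp add: nth_append)
qed

lemma cycle_line_triple:
  "cycle_line f [a, b, c] =
     butlast (edge_line f a b) @ butlast (edge_line f b c) @ butlast (edge_line f c a)"
  by (simp add: cycle_line_def)

lemma cycle_winding_triple:
  assumes "is_plane_map K f" "{a, b} \<in> snd K" "{b, c} \<in> snd K" "{c, a} \<in> snd K"
  shows "2 * pi * cycle_winding f [a, b, c] v =
    line_angle (edge_line f a b) (vertex_point f v) +
    line_angle (edge_line f b c) (vertex_point f v) +
    line_angle (edge_line f c a) (vertex_point f v)"
proof -
  let ?X = "edge_line f a b" and ?Y = "edge_line f b c" and ?Z = "edge_line f c a"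
  have len: "2 \<le> length ?X" "2 \<le> length ?Y" "2 \<le> length ?Z"
    and ends: "last ?X = hd ?Y" "last ?Y = hd ?Z" "last ?Z = hd ?X"
    using assms unfolding is_plane_map_def by metis+
  then have ne: "?X \<noteq> []" "?Y \<noteq> []" "?Z \<noteq> []" "butlast ?X \<noteq> []" "butlast ?Y \<noteq> []"
    by (auto simp: butlast_conv_take)
  have hd_butlast: "hd (butlast L) = hd L" if "2 \<le> length L" for L :: "complex list"
    using that by (cases L) (auto simp: Suc_le_eq)
  \<comment> \<open>Closing the cycle by repeating its first point restores exactly the end point
    that \<open>butlast\<close> drops from \<open>?Z\<close>.\<close>
  have "butlast ?X @ butlast ?Y @ butlast ?Z @ [hd ?X] = butlast ?X @ butlast ?Y @ ?Z"
    using ne ends by (metis append_butlast_last_id)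
  moreover have "line_angle (butlast ?X @ butlast ?Y @ ?Z) P
      = line_angle ?X P + line_angle ?Y P + line_angle ?Z P" for P
    using ne ends len by (simp add: line_angle_append hd_butlast)
  moreover have "hd (cycle_line f [a, b, c]) = hd ?X"
    using ne len by (simp add: cycle_line_triple hd_butlast)
  ultimately have "line_angle (cycle_line f [a, b, c] @ [hd (cycle_line f [a, b, c])]) P
      = line_angle ?X P + line_angle ?Y P + line_angle ?Z P" for P
    by (simp only: cycle_line_triple append_assoc)
  thus ?thesis
    using ne by (simp add: cycle_winding_def cycle_line_triple closed_line_winding_conv_line_angle)
qed

lemma cycle_winding_triple_in_Ints:
  assumes "almost_embedding K f" "{a, b} \<in> snd K" "{b, c} \<in> snd K" "{c, a} \<in> snd K"
    and "v \<in> fst K" "v \<notin> {a, b, c}"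
  shows "cycle_winding f [a, b, c] v \<in> \<int>"
proof -
  have "vertex_point f v \<notin> set (edge_line f x y)" if "{x, y} \<in> snd K" "v \<notin> {x, y}" for x y
    using assms(1,5) that set_subset_line_image[of "edge_line f x y"]
    unfolding almost_embedding_def is_plane_map_def by blast
  then have "vertex_point f v \<notin> set (cycle_line f [a, b, c])"
    using assms by (auto simp: cycle_line_triple dest!: in_set_butlastD)
  thus ?thesis
    unfolding cycle_winding_def by (rule closed_line_winding_in_Ints)
qed

section \<open>The triangle and the parity count\<close>

text \<open>Up to order, the three numerators are the negatives of the three denominators, so the
  product of the quotients is (-1)^3 = -1.\<close>

lemma triangle_angle_sum_odd:
  assumes "x \<noteq> y" "y \<noteq> z" "z \<noteq> x"
    and "cis \<alpha> = sgn (z - x) / sgn (y - x)"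
    and "cis \<beta> = sgn (x - y) / sgn (z - y)"
    and "cis \<gamma> = sgn (y - z) / sgn (x - z)"
  shows "\<exists>k::int. \<alpha> + \<beta> + \<gamma> = (2 * of_int k + 1) * pi"
proof -
  have neg: "sgn (y - x) = - sgn (x - y)" "sgn (z - y) = - sgn (y - z)"
    "sgn (x - z) = - sgn (z - x)"
    by (metis minus_diff_eq sgn_minus)+
  have "cis (\<alpha> + \<beta> + \<gamma>) = -1"
    using assms by (simp add: cis_mult[symmetric] neg sgn_zero_iff)
  then have "cis (\<alpha> + \<beta> + \<gamma> - pi) = 1"
    by (simp add: cis_divide[symmetric])
  then have "cos (\<alpha> + \<beta> + \<gamma> - pi) = 1"
    by (metis cis.simps(1) one_complex.simps(1))
  then obtain k :: int where "\<alpha> + \<beta> + \<gamma> - pi = of_int k * (2 * pi)"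
    using cos_one_2pi_int[of "\<alpha> + \<beta> + \<gamma> - pi"] by (auto simp: algebra_simps)
  thus ?thesis by (intro exI[of _ k]) (simp add: algebra_simps)
qed

theorem theorem5p2:
  fixes f :: "nat plane_map"
  assumes "almost_embedding (complete_graph 4) f"
  shows "[cycle_winding f [2, 3, 4] 1 + cycle_winding f [1, 3, 4] 2
        + cycle_winding f [1, 2, 4] 3 + cycle_winding f [1, 2, 3] 4 = 1] (rmod 2)"
proof -
  define \<theta> where "\<theta> u v w = line_angle (edge_line f u v) (vertex_point f w)" for u v w
  let ?p = "vertex_point f" and ?V = "{1, 2, 3, 4 :: nat}"
  have V: "fst (complete_graph 4) = ?V"
    by (auto simp: complete_graph_def)
  have E: "{u, v} \<in> snd (complete_graph 4)" if "u \<in> ?V" "v \<in> ?V" "u \<noteq> v" for u v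
    unfolding complete_graph_def snd_conv mem_Collect_eq
    by (intro exI[of _ u] exI[of _ v]) (use that in auto)
  have map: "is_plane_map (complete_graph 4) f" and inj: "inj_on ?p ?V"
    using assms unfolding almost_embedding_def V by auto
  have line: "2 \<le> length (edge_line f u v)" "edge_line f u v \<noteq> []"
      "hd (edge_line f u v) = ?p u" "last (edge_line f u v) = ?p v" "edge_line f v u = rev (edge_line f u v)"
    if "u \<in> ?V" "v \<in> ?V" "u \<noteq> v" for u v
    using map E[OF that] unfolding is_plane_map_def by force+
  have off: "?p w \<notin> line_image (edge_line f u v)"
    if "u \<in> ?V" "v \<in> ?V" "u \<noteq> v" "w \<in> ?V" "w \<notin> {u, v}" for u v w
    using assms E[of u v] that unfolding almost_embedding_def V by blast
  have rev: "\<theta> v u w = - \<theta> u v w"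
    if "u \<in> ?V" "v \<in> ?V" "u \<noteq> v" "w \<in> ?V" "w \<notin> {u, v}" for u v w
    using line_angle_rev[OF off[OF that]] line(5)[OF that(1-3)] by (simp add: \<theta>_def)
  have exchange: "\<theta> x y u - \<theta> x y v = \<theta> u v x - \<theta> u v y"
    if "u \<in> ?V" "v \<in> ?V" "u \<noteq> v" "x \<in> ?V" "y \<in> ?V" "x \<noteq> y" "{u, v} \<inter> {x, y} = {}" for u v x y
  proof -
    have "line_image (edge_line f u v) \<inter> line_image (edge_line f x y) = {}"
      using assms E[OF that(1-3)] E[OF that(4-6)] that(7) unfolding almost_embedding_def by blast
    from line_angle_exchange[OF _ _ this] show ?thesis
      using line[OF that(1-3)] line[OF that(4-6)] by (simp add: \<theta>_def)
  qed
  have cis: "cis (\<theta> u v w) = sgn (?p v - ?p w) / sgn (?p u - ?p w)"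
    if "u \<in> ?V" "v \<in> ?V" "u \<noteq> v" "w \<in> ?V" "w \<notin> {u, v}" for u v w
  proof -
    have "?p w \<notin> set (edge_line f u v)"
      using off[OF that] set_subset_line_image[OF line(1)[OF that(1-3)]] by blast
    from cis_line_angle[OF this] show ?thesis
      using line[OF that(1-3)] by (simp add: \<theta>_def)
  qed
  have winding: "2 * pi * cycle_winding f [a, b, c] v = \<theta> a b v + \<theta> b c v + \<theta> c a v"
    if "a \<in> ?V" "b \<in> ?V" "c \<in> ?V" "distinct [a, b, c]" for a b c v
    using that unfolding \<theta>_def by (intro cycle_winding_triple[OF map] E) auto
  have ints: "cycle_winding f [a, b, c] v \<in> \<int>"
    if "a \<in> ?V" "b \<in> ?V" "c \<in> ?V" "distinct [a, b, c]" "v \<in> ?V" "v \<notin> {a, b, c}" for a b c v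
    using that by (intro cycle_winding_triple_in_Ints[OF assms] E) (auto simp: V)
  define w1 w2 w3 w4 where "w1 = cycle_winding f [2, 3, 4] 1"
    and "w2 = cycle_winding f [1, 3, 4] 2"
    and "w3 = cycle_winding f [1, 2, 4] 3" and "w4 = cycle_winding f [1, 2, 3] 4"
  obtain i1 i2 i4 :: int where i: "w1 = of_int i1" "w2 = of_int i2" "w4 = of_int i4"
    using ints[of 2 3 4 1] ints[of 1 3 4 2] ints[of 1 2 3 4]
    unfolding w1_def w2_def w4_def by (force elim!: Ints_cases)
  have "?p 2 \<noteq> ?p 3" "?p 3 \<noteq> ?p 4" "?p 4 \<noteq> ?p 2"
    using inj by (auto simp: inj_on_def)
  then obtain k :: int where k: "\<theta> 3 4 2 + \<theta> 4 2 3 + \<theta> 2 3 4 = (2 * of_int k + 1) * pi"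
    using triangle_angle_sum_odd[of "?p 2" "?p 3" "?p 4" "\<theta> 3 4 2" "\<theta> 4 2 3" "\<theta> 2 3 4"]
    by (auto simp: cis)
  have w: "2 * pi * w1 = \<theta> 2 3 1 + \<theta> 3 4 1 + \<theta> 4 2 1"
    "2 * pi * w2 = \<theta> 1 3 2 + \<theta> 3 4 2 + \<theta> 4 1 2"
    "2 * pi * w3 = \<theta> 1 2 3 + \<theta> 2 4 3 + \<theta> 4 1 3"
    "2 * pi * w4 = \<theta> 1 2 4 + \<theta> 2 3 4 + \<theta> 3 1 4"
    unfolding w1_def w2_def w3_def w4_def by (rule winding; simp)+
  \<comment> \<open>One identity for each pair of opposite edges: 12 and 34, 13 and 24, 14 and
    23.\<close>
  have "\<theta> 3 4 1 - \<theta> 3 4 2 = \<theta> 1 2 3 - \<theta> 1 2 4"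
    "\<theta> 2 4 1 - \<theta> 2 4 3 = \<theta> 1 3 2 - \<theta> 1 3 4"
    "\<theta> 2 3 1 - \<theta> 2 3 4 = \<theta> 1 4 2 - \<theta> 1 4 3"
    by (rule exchange; simp)+
  moreover have "\<theta> 4 2 1 = - \<theta> 2 4 1" "\<theta> 4 2 3 = - \<theta> 2 4 3" "\<theta> 4 1 2 = - \<theta> 1 4 2"
    "\<theta> 4 1 3 = - \<theta> 1 4 3" "\<theta> 3 1 4 = - \<theta> 1 3 4"
    by (rule rev; simp)+
  \<comment> \<open>The identities trade the angles along the edges at 1 for angles along the sides
    of 234, so each of the latter occurs twice.\<close>
  ultimately have "2 * pi * w1 - 2 * pi * w2 + 2 * pi * w3 - 2 * pi * w4
      = 2 * (2 * pi * w1) - 2 * (\<theta> 3 4 2 + \<theta> 4 2 3 + \<theta> 2 3 4)"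
    unfolding w by argo
  then have "2 * pi * (w1 - w2 + w3 - w4)
      = 2 * (2 * pi * w1) - 2 * (\<theta> 3 4 2 + \<theta> 4 2 3 + \<theta> 2 3 4)"
    by (simp only: right_diff_distrib distrib_left)
  also have "\<dots> = 2 * pi * (2 * w1 - (2 * of_int k + 1))"
    unfolding k by (simp add: algebra_simps)
  finally have "w1 - w2 + w3 - w4 = 2 * w1 - (2 * of_int k + 1)"
    by simp
  \<comment> \<open>Passing from the alternating to the plain sum adds
    \<open>2 * w2 + 2 * w4\<close>. With \<open>2 * w1\<close> this is even by integrality, and the
    odd number \<open>2 * k + 1\<close> from the triangle decides the parity.\<close>
  then have "w1 + w2 + w3 + w4 = 1 + of_int (i1 + i2 + i4 - k - 1) * 2"
    by (simp add: i)
  then have "[1 = w1 + w2 + w3 + w4] (rmod 2)"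
    unfolding rcong_altdef by (rule exI)
  thus ?thesis
    unfolding w1_def w2_def w3_def w4_def by (rule rcong_sym)
qed

end
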